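(* Let $A$ be an $n\times n$ dilation matrix, $F=[-\tfrac12,\tfrac12)^n$, $D=A(F)\cap\mathbb{Z}^n$, and let $\|\cdot\|'$ be the norm $\|x\|'=(\sum_{j\ge0}\|A^{-j}x\|_2^2)^{1/2}$. Put $m=\min\{\|Ax\|':\|x\|'=1\}$, $M=\max\{\|Ax\|':\|x\|'=1\}$, $\rho=\max\{\|f\|':f\in \overline{F}\}$, and $R=\frac{M\rho}{m-1}$. For $x_0\in\mathbb{Z}^n$ let $(x_j)_{j\ge0}$ be the sequence defined by the Euclidean algorithm $x_j=Ax_{j+1}+r_j$ with $x_{j+1}\in\mathbb{Z}^n$, $r_j\in D$. Then $m>1$, and: if $\|x_j\|'>R$ then $\|x_{j+1}\|'<\|x_j\|'$; and if $\|x_j\|'\le R$ then $\|x_{j+1}\|'\le R$. Consequently there is $N$ such that $\|x_j\|'\le R$ for all $j\ge N$, and the sequence $(x_j)$ is eventually periodic.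
   Context: A dilation matrix is an $n\times n$ matrix with integer entries all of whose eigenvalues $\lambda$ satisfy $|\lambda|>1$. $D$ is a complete set of coset representatives of $\mathbb{Z}^n/A(\mathbb{Z}^n)$, so the decomposition $x_j=Ax_{j+1}+r_j$ is unique. *)

theory Defs
  imports "HOL-Analysis.Analysis"
begin

text \<open>Integer lattice Z^n inside R^n (dimension = CARD('n)).\<close>
definition int_vecs :: "(real^'n) set" where
  "int_vecs = {x. \<forall>i. x $ i \<in> \<int>}"

text \<open>Complex eigenvalues of a real square matrix.\<close>
definition complex_eigenvalue :: "real^'n^'n \<Rightarrow> complex \<Rightarrow> bool" where
  "complex_eigenvalue A c \<longleftrightarrow>
     (\<exists>v::complex^'n. v \<noteq> 0 \<and>
        (\<chi> i j. complex_of_real (A $ i $ j)) *v v = c *s v)"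

text \<open>Dilation matrix: integer entries, all eigenvalues of modulus > 1.\<close>
definition dilation_matrix :: "real^'n^'n \<Rightarrow> bool" where
  "dilation_matrix A \<longleftrightarrow> (\<forall>i j. A $ i $ j \<in> \<int>) \<and>
     (\<forall>c. complex_eigenvalue A c \<longrightarrow> 1 < cmod c)"

text \<open>F = [-1/2,1/2)^n.\<close>
definition half_cube :: "(real^'n) set" where
  "half_cube = {x. \<forall>i. -1/2 \<le> x $ i \<and> x $ i < 1/2}"

text \<open>Digit set D = A(F) \<inter> Z^n.\<close>
definition digits :: "real^'n^'n \<Rightarrow> (real^'n) set" where
  "digits A = ((\<lambda>x. A *v x) ` half_cube) \<inter> int_vecs"

text \<open>The norm ||x||' = (sum_{j>=0} ||A^{-j} x||_2^2)^{1/2}.\<close>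
definition normA :: "real^'n^'n \<Rightarrow> real^'n \<Rightarrow> real" where
  "normA A x = sqrt (\<Sum>j. (norm (((\<lambda>v. matrix_inv A *v v) ^^ j) x))\<^sup>2)"

end

theory Submission
  imports Defs "Jordan_Normal_Form.Spectral_Radius"
begin

(* Proof outline.
   Write B for the inverse of the dilation matrix A. The eigenvalues of B lie in the open
   unit disc, so (via the Jordan normal form, transported from the type-indexed matrices
   of HOL-Analysis to the list-based matrices of Jordan_Normal_Form) the powers of B decay
   geometrically. Hence the series defining ||x||' converges, ||.||' is a norm dominating the
   Euclidean norm, and ||A x||'^2 = ||A x||^2 + ||x||'^2, which yields m > 1 and
   ||B z||' <= ||z||' / m.
   One division step x = A y + A f with f in the cube F gives y = B x - f, hence
   ||y||' <= ||x||' / m + rho; elementary arithmetic turns this into the two statements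
   about R = M rho / (m - 1). Since ||.||' dominates the Euclidean norm, sublevel sets of
   ||.||' contain finitely many lattice points; together with the uniqueness of the
   quotient y this gives eventual boundedness and eventual periodicity by two general
   lemmas about sequences. *)

no_notation vec_index (infixl "$" 100)
hide_const (open) Matrix.mat Matrix.vec

section \<open>Geometric decay of matrix powers\<close>

text \<open>Powers of a scaled square matrix.\<close>
lemma smult_pow_mat:
  fixes C :: "'a::comm_ring_1 mat"
  assumes "C \<in> carrier_mat n n"
  shows "(a \<cdot>\<^sub>m C) ^\<^sub>m k = a ^ k \<cdot>\<^sub>m (C ^\<^sub>m k)"
proof (induction k)
  case 0
  show ?case by (rule eq_matI) auto
next
  case (Suc k)
  have "(a \<cdot>\<^sub>m C) ^\<^sub>m Suc k = (a ^ k \<cdot>\<^sub>m C ^\<^sub>m k) * (a \<cdot>\<^sub>m C)"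
    by (simp add: Suc.IH)
  also have "\<dots> = a ^ k \<cdot>\<^sub>m (a \<cdot>\<^sub>m (C ^\<^sub>m k * C))"
    using mult_smult_assoc_mat[of "C ^\<^sub>m k" n n "a \<cdot>\<^sub>m C" n]
      mult_smult_distrib[of "C ^\<^sub>m k" n n C n] assms by simp
  also have "\<dots> = a ^ Suc k \<cdot>\<^sub>m (C ^\<^sub>m Suc k)"
    by (rule eq_matI) auto
  finally show ?case .
qed

text \<open>Multiplying a scaled matrix with a vector.\<close>
lemma smult_mat_mult_vec:
  assumes "v \<in> carrier_vec (dim_col A)"
  shows "(a \<cdot>\<^sub>m A) *\<^sub>v v = a \<cdot>\<^sub>v (A *\<^sub>v v)"
  using assms by (intro eq_vecI) (auto simp: scalar_prod_def sum_distrib_left mult.assoc)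

text \<open>If all eigenvalues of a complex matrix lie in the open unit disc, the entries of its
  powers decay geometrically: scale the matrix by the inverse of a number q strictly
  between the spectral radius and 1, and use that powers of a matrix of spectral radius
  below 1 are bounded.\<close>
lemma jnf_power_decay:
  fixes D :: "complex mat"
  assumes D: "D \<in> carrier_mat n n" and ev: "\<And>\<mu>. eigenvalue D \<mu> \<Longrightarrow> cmod \<mu> < 1"
  shows "\<exists>c q. 0 < q \<and> q < 1 \<and> (\<forall>k. norm_bound (D ^\<^sub>m k) (c * q ^ k))"
proof (cases "n = 0")
  case True
  have "norm_bound (D ^\<^sub>m k) (0 * (1/2) ^ k)" for k
    using D True by (auto simp: norm_bound_def)
  then show ?thesis by (intro exI[of _ 0] exI[of _ "1/2"]) auto
next
  case False
  define s where "s = spectral_radius D"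
  obtain \<mu>0 where "eigenvalue D \<mu>0" "s = cmod \<mu>0"
    using spectral_radius_mem_max(1)[OF D] False unfolding s_def spectrum_def by auto
  with ev have s: "0 \<le> s" "s < 1" by auto
  define q where "q = (1 + s) / 2"
  have q: "0 < q" "q < 1" "s < q" using s by (auto simp: q_def)
  define C where "C = (1 / q) \<cdot>\<^sub>m D"
  have C: "C \<in> carrier_mat n n" using D by (simp add: C_def)
  have DC: "D = q \<cdot>\<^sub>m C" using q(1) by (auto simp: C_def)
  have "cmod \<mu> < 1" if ev_C: "eigenvalue C \<mu>" for \<mu>
  proof -
    have dims: "dim_row C = n" "dim_col C = n" "dim_row D = n" using C D by auto
    obtain v where v: "v \<in> carrier_vec n" "v \<noteq> 0\<^sub>v n" "C *\<^sub>v v = \<mu> \<cdot>\<^sub>v v"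
      using ev_C unfolding eigenvalue_def eigenvector_def dims by blast
    have "D *\<^sub>v v = (q * \<mu>) \<cdot>\<^sub>v v"
      unfolding DC using v dims by (simp add: smult_mat_mult_vec smult_smult_assoc)
    hence "eigenvalue D (q * \<mu>)"
      using v unfolding eigenvalue_def eigenvector_def dims by blast
    hence "cmod (q * \<mu>) \<le> s"
      using spectral_radius_mem_max(2)[OF D] False unfolding s_def spectrum_def by auto
    hence "q * cmod \<mu> \<le> s"
      using q(1) by (simp add: norm_mult)
    with q show ?thesis by (metis less_le_trans mult_less_cancel_left_pos mult.right_neutral not_le)
  qed
  hence "spectral_radius C < 1"
    using spectral_radius_mem_max(1)[OF C] False unfolding spectrum_def by auto
  then obtain c where c: "\<And>k. norm_bound (C ^\<^sub>m k) c"
    using spectral_radius_jnf_norm_bound_less_1_upper_triangular[OF C] by auto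
  have "norm_bound (D ^\<^sub>m k) (c * q ^ k)" for k
    using c[of k] q(1) C unfolding DC smult_pow_mat[OF C] norm_bound_def
    by (auto simp: norm_mult norm_power mult.commute intro: mult_left_mono)
  with q show ?thesis by blast
qed

text \<open>An entrywise bound on a matrix bounds the components of its products with vectors.\<close>
lemma norm_bound_mult_vec:
  fixes M :: "'a::real_normed_field mat"
  assumes M: "M \<in> carrier_mat n n" and b: "norm_bound M b"
    and w: "w \<in> carrier_vec n" and i: "i < n"
  shows "norm (vec_index (M *\<^sub>v w) i) \<le> b * (\<Sum>j<n. norm (vec_index w j))"
proof -
  have "norm (vec_index (M *\<^sub>v w) i) = norm (\<Sum>j<n. M $$ (i, j) * vec_index w j)"
    using M w i by (simp add: scalar_prod_def lessThan_atLeast0)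
  also have "\<dots> \<le> (\<Sum>j<n. norm (M $$ (i, j)) * norm (vec_index w j))"
    by (rule order_trans[OF norm_sum]) (simp add: norm_mult)
  also have "\<dots> \<le> (\<Sum>j<n. b * norm (vec_index w j))"
    using M b i unfolding norm_bound_def by (intro sum_mono mult_right_mono) auto
  finally show ?thesis by (simp add: sum_distrib_left)
qed

text \<open>An enumeration of a finite index type transports matrices and vectors indexed by that
  type to matrices and vectors of Jordan_Normal_Form, preserving products, powers and
  eigenvalues.\<close>
locale enumeration =
  fixes ix :: "nat \<Rightarrow> 'n::finite"
  assumes bij: "bij_betw ix {..<CARD('n)} UNIV"
begin

definition toM :: "'a^'n^'n \<Rightarrow> 'a mat" where
  "toM X = Matrix.mat CARD('n) CARD('n) (\<lambda>(i, j). X $ ix i $ ix j)"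

definition toV :: "'a^'n \<Rightarrow> 'a vec" where
  "toV v = Matrix.vec CARD('n) (\<lambda>i. v $ ix i)"

definition fromV :: "'a vec \<Rightarrow> 'a^'n" where
  "fromV w = (\<chi> j. vec_index w (inv_into {..<CARD('n)} ix j))"

lemma toM_carrier [simp]: "toM X \<in> carrier_mat CARD('n) CARD('n)"
  and toM_dim [simp]: "dim_row (toM X) = CARD('n)" "dim_col (toM X) = CARD('n)"
  by (simp_all add: toM_def)

lemma toV_carrier [simp]: "toV v \<in> carrier_vec CARD('n)"
  by (simp add: toV_def)

lemma sum_reindex: "(\<Sum>i<CARD('n). f (ix i)) = (\<Sum>j\<in>UNIV. f j)"
  using sum.reindex_bij_betw[OF bij] by simp

lemma toV_mult: "toV (X *v v) = toM X *\<^sub>v toV v"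
  by (rule eq_vecI)
    (simp_all add: toV_def toM_def scalar_prod_def matrix_vector_mult_def
      lessThan_atLeast0[symmetric] sum_reindex[where f = "\<lambda>j. X $ _ $ j * v $ j"])

lemma fromV_index: "i < CARD('n) \<Longrightarrow> fromV w $ ix i = vec_index w i"
  using bij by (simp add: fromV_def bij_betw_def inv_into_f_f)

lemma toV_fromV: "w \<in> carrier_vec CARD('n) \<Longrightarrow> toV (fromV w) = w"
  by (intro eq_vecI) (auto simp: toV_def fromV_index)

lemma toV_inj:
  assumes "toV v = toV w"
  shows "v = w"
proof (subst Finite_Cartesian_Product.vec_eq_iff, rule allI)
  fix j :: 'n
  have "j \<in> ix ` {..<CARD('n)}" using bij by (simp add: bij_betw_def)
  then obtain i where "i < CARD('n)" "ix i = j" by auto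
  moreover have "vec_index (toV v) i = vec_index (toV w) i" using assms by simp
  ultimately show "v $ j = w $ j" by (simp add: toV_def)
qed

lemma toV_iter: "toV (((*v) X ^^ k) v) = toM X ^\<^sub>m k *\<^sub>v toV v"
proof (induction k arbitrary: v)
  case 0
  show ?case by (simp add: toM_def)
next
  case (Suc k)
  have "toV (((*v) X ^^ Suc k) v) = toM X ^\<^sub>m k *\<^sub>v (toM X *\<^sub>v toV v)"
    by (simp add: funpow_Suc_right Suc.IH toV_mult del: funpow.simps)
  also have "\<dots> = toM X ^\<^sub>m Suc k *\<^sub>v toV v"
    by (simp add: assoc_mult_mat_vec[of _ "CARD('n)" "CARD('n)" _ "CARD('n)"])
  finally show ?case .
qed

text \<open>An eigenvalue of the transferred matrix is an eigenvalue of the original one.\<close>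
lemma eigenvalue_toM:
  assumes "eigenvalue (toM X) \<mu>"
  shows "\<exists>v. v \<noteq> 0 \<and> X *v v = \<mu> *s v"
proof -
  obtain w where w: "w \<in> carrier_vec CARD('n)" "w \<noteq> 0\<^sub>v CARD('n)" "toM X *\<^sub>v w = \<mu> \<cdot>\<^sub>v w"
    using assms unfolding eigenvalue_def eigenvector_def by (auto simp: toM_def)
  have "toV (X *v fromV w) = toV (\<mu> *s fromV w)"
    using w by (simp add: toV_mult toV_fromV) (rule eq_vecI; simp add: toV_def fromV_index)
  moreover have "fromV w \<noteq> 0"
  proof
    assume "fromV w = 0"
    hence "w = toV 0" using toV_fromV[OF w(1)] by simp
    also have "toV 0 = 0\<^sub>v CARD('n)" by (rule eq_vecI) (simp_all add: toV_def)
    finally show False using w(2) by simp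
  qed
  ultimately show ?thesis using toV_inj by blast
qed

end

text \<open>A vector norm is bounded by the sum of the norms of its components.\<close>
lemma norm_le_sum_components: "norm (v :: 'a::real_normed_vector^'n) \<le> (\<Sum>i\<in>UNIV. norm (v $ i))"
  by (simp add: norm_vec_def L2_set_le_sum)

text \<open>A complex matrix all of whose eigenvalues lie in the open unit disc has
  geometrically decaying powers.\<close>
lemma complex_matrix_power_decay:
  fixes X :: "complex^'n^'n"
  assumes ev: "\<And>v \<mu>. v \<noteq> 0 \<Longrightarrow> X *v v = \<mu> *s v \<Longrightarrow> cmod \<mu> < 1"
  shows "\<exists>c q. 0 \<le> c \<and> 0 < q \<and> q < 1 \<and> (\<forall>k v. norm (((*v) X ^^ k) v) \<le> c * q ^ k * norm v)"
proof -
  obtain ix :: "nat \<Rightarrow> 'n" where "bij_betw ix {..<CARD('n)} UNIV"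
    using ex_bij_betw_nat_finite[of "UNIV :: 'n set"] by (auto simp: atLeast0LessThan)
  then interpret enumeration ix by unfold_locales
  let ?n = "CARD('n)"
  obtain c q where q: "0 < q" "q < 1" and c: "\<And>k. norm_bound (toM X ^\<^sub>m k) (c * q ^ k)"
    using jnf_power_decay[OF toM_carrier] eigenvalue_toM ev by blast
  have "\<forall>i<?n. \<forall>j<?n. cmod (if i = j then 1 else 0) \<le> c"
    using c[of 0] unfolding norm_bound_def by simp
  hence c0: "0 \<le> c" by (metis norm_ge_zero order_trans zero_less_card_finite)
  have component: "norm ((((*v) X ^^ k) v) $ ix i) \<le> c * q ^ k * (real ?n * norm v)"
    if i: "i < ?n" for i k v
  proof -
    have "(\<Sum>j<?n. norm (vec_index (toV v) j)) = (\<Sum>j\<in>UNIV. norm (v $ j))"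
      by (simp add: toV_def sum_reindex[where f = "\<lambda>j. norm (v $ j)", symmetric])
    also have "\<dots> \<le> (\<Sum>j\<in>(UNIV :: 'n set). norm v)"
      by (intro sum_mono Finite_Cartesian_Product.norm_nth_le)
    finally have l1: "(\<Sum>j<?n. norm (vec_index (toV v) j)) \<le> real ?n * norm v"
      by simp
    have "(((*v) X ^^ k) v) $ ix i = vec_index (toV (((*v) X ^^ k) v)) i"
      using i by (simp add: toV_def)
    also have "\<dots> = vec_index (toM X ^\<^sub>m k *\<^sub>v toV v) i"
      by (simp only: toV_iter)
    finally have "norm ((((*v) X ^^ k) v) $ ix i)
        \<le> c * q ^ k * (\<Sum>j<?n. norm (vec_index (toV v) j))"
      using norm_bound_mult_vec[OF pow_carrier_mat[OF toM_carrier] c toV_carrier i] by simp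
    also have "\<dots> \<le> c * q ^ k * (real ?n * norm v)"
      using l1 q c0 by (intro mult_left_mono) auto
    finally show ?thesis .
  qed
  have "norm (((*v) X ^^ k) v) \<le> real ?n * real ?n * c * q ^ k * norm v" for k v
  proof -
    have "norm (((*v) X ^^ k) v) \<le> (\<Sum>i<?n. norm ((((*v) X ^^ k) v) $ ix i))"
      unfolding sum_reindex[where f = "\<lambda>j. norm ((((*v) X ^^ k) v) $ j)"]
      by (rule norm_le_sum_components)
    also have "\<dots> \<le> (\<Sum>i<?n. c * q ^ k * (real ?n * norm v))"
      by (intro sum_mono component) simp
    finally show ?thesis by (simp add: mult_ac)
  qed
  with q c0 show ?thesis by (intro exI[of _ "real ?n * real ?n * c"] exI[of _ q]) auto
qed

text \<open>Complex eigenvalues of real matrices are handled through the complexification.\<close>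
definition complexify :: "real^'n \<Rightarrow> complex^'n" where
  "complexify x = (\<chi> i. complex_of_real (x $ i))"

definition complexify_mat :: "real^'n^'m \<Rightarrow> complex^'n^'m" where
  "complexify_mat X = (\<chi> i j. complex_of_real (X $ i $ j))"

lemma complexify_mult: "complexify (X *v x) = complexify_mat X *v complexify x"
  by (simp add: Finite_Cartesian_Product.vec_eq_iff complexify_def complexify_mat_def matrix_vector_mult_def)

lemma complexify_iter:
  fixes X :: "real^'n^'n"
  shows "complexify (((*v) X ^^ k) x) = ((*v) (complexify_mat X) ^^ k) (complexify x)"
  by (induction k) (simp_all add: complexify_mult)

lemma norm_complexify: "norm (complexify x) = norm x"
  by (simp add: norm_vec_def complexify_def)

lemma complexify_eq_0_iff: "complexify x = 0 \<longleftrightarrow> x = 0"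
  by (simp add: Finite_Cartesian_Product.vec_eq_iff complexify_def)

lemma complexify_mat_mult: "complexify_mat (X ** Y) = complexify_mat X ** complexify_mat Y"
  by (simp add: Finite_Cartesian_Product.vec_eq_iff complexify_mat_def matrix_matrix_mult_def)

lemma complexify_mat_one: "complexify_mat (mat 1) = mat 1"
  by (simp add: Finite_Cartesian_Product.vec_eq_iff complexify_mat_def Finite_Cartesian_Product.mat_def)

lemma complex_eigenvalue_iff:
  "complex_eigenvalue X \<mu> \<longleftrightarrow> (\<exists>v. v \<noteq> 0 \<and> complexify_mat X *v v = \<mu> *s v)"
  by (simp add: complex_eigenvalue_def complexify_mat_def)

text \<open>A real matrix whose complex eigenvalues all lie in the open unit disc has
  geometrically decaying powers.\<close>
lemma real_matrix_power_decay:
  fixes B :: "real^'n^'n"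
  assumes "\<And>\<mu>. complex_eigenvalue B \<mu> \<Longrightarrow> cmod \<mu> < 1"
  shows "\<exists>c q. 0 \<le> c \<and> 0 < q \<and> q < 1 \<and> (\<forall>k x. norm (((*v) B ^^ k) x) \<le> c * q ^ k * norm x)"
proof -
  obtain c q where "0 \<le> c" "0 < q" "q < 1"
    and decay: "\<And>k v. norm (((*v) (complexify_mat B) ^^ k) v) \<le> c * q ^ k * norm v"
    using complex_matrix_power_decay[of "complexify_mat B"] assms
    unfolding complex_eigenvalue_iff by blast
  moreover have "norm (((*v) B ^^ k) x) \<le> c * q ^ k * norm x" for k x
    using decay[of k "complexify x"] by (simp add: complexify_iter[symmetric] norm_complexify)
  ultimately show ?thesis by blast
qed

section \<open>The norm attached to a dilation matrix\<close>

text \<open>A dilation matrix is invertible, since 0 is not one of its eigenvalues.\<close>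
lemma dilation_invertible:
  assumes "dilation_matrix A"
  shows "matrix_inv A ** A = mat 1" and "A ** matrix_inv A = mat 1"
proof -
  have "x = 0" if "A *v x = 0" for x
  proof (rule ccontr)
    assume "x \<noteq> 0"
    moreover have "complexify_mat A *v complexify x = 0 *s complexify x"
      using that by (simp add: complexify_mult[symmetric] complexify_eq_0_iff)
    ultimately have "complex_eigenvalue A 0"
      unfolding complex_eigenvalue_iff by (metis complexify_eq_0_iff)
    thus False using assms by (fastforce simp: dilation_matrix_def)
  qed
  then obtain B where "B ** A = mat 1"
    using matrix_left_invertible_ker by blast
  hence "\<exists>B. A ** B = mat 1 \<and> B ** A = mat 1"
    using matrix_left_right_inverse by blast
  hence "A ** matrix_inv A = mat 1 \<and> matrix_inv A ** A = mat 1"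
    unfolding matrix_inv_def by (rule someI_ex)
  thus "matrix_inv A ** A = mat 1" and "A ** matrix_inv A = mat 1" by blast+
qed

text \<open>The eigenvalues of the inverse of a dilation matrix lie in the open unit disc.\<close>
lemma dilation_inverse_eigenvalues:
  assumes dil: "dilation_matrix A" and ev: "complex_eigenvalue (matrix_inv A) \<mu>"
  shows "cmod \<mu> < 1"
proof -
  obtain v where v: "v \<noteq> 0" "complexify_mat (matrix_inv A) *v v = \<mu> *s v"
    using ev unfolding complex_eigenvalue_iff by blast
  have "v = complexify_mat A *v (complexify_mat (matrix_inv A) *v v)"
    by (simp add: matrix_vector_mul_assoc complexify_mat_mult[symmetric]
        dilation_invertible(2)[OF dil] complexify_mat_one)
  also have "\<dots> = \<mu> *s (complexify_mat A *v v)"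
    using v(2) by (simp add: vector_scalar_commute)
  finally have v_eq: "v = \<mu> *s (complexify_mat A *v v)" .
  with v(1) have "\<mu> \<noteq> 0" by auto
  have "complexify_mat A *v v = (1 / \<mu>) *s v"
    using \<open>\<mu> \<noteq> 0\<close> by (subst (2) v_eq) (simp add: vector_smult_assoc)
  hence "complex_eigenvalue A (1 / \<mu>)"
    unfolding complex_eigenvalue_iff using v(1) by blast
  hence "1 < cmod (1 / \<mu>)" using dil by (simp add: dilation_matrix_def)
  thus ?thesis using \<open>\<mu> \<noteq> 0\<close> by (simp add: norm_divide field_simps)
qed

text \<open>The iterates of the inverse matrix that enter the definition of the norm.\<close>
definition inv_iter :: "real^'n^'n \<Rightarrow> nat \<Rightarrow> real^'n \<Rightarrow> real^'n" where
  "inv_iter A j = ((*v) (matrix_inv A) ^^ j)"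

lemma normA_inv_iter: "normA A x = sqrt (\<Sum>j. (norm (inv_iter A j x))\<^sup>2)"
  by (simp add: normA_def inv_iter_def)

text \<open>Each iterate is linear.\<close>
lemma inv_iter_add: "inv_iter A j (x + y) = inv_iter A j x + inv_iter A j y"
  by (induction j) (simp_all add: inv_iter_def matrix_vector_right_distrib)

lemma inv_iter_scaleR: "inv_iter A j (t *\<^sub>R x) = t *\<^sub>R inv_iter A j x"
  by (induction j) (simp_all add: inv_iter_def matrix_vector_mult_scaleR)

lemma inv_iter_Suc: "inv_iter A (Suc j) x = inv_iter A j (matrix_inv A *v x)"
  by (simp add: inv_iter_def funpow_Suc_right del: funpow.simps)

text \<open>From here on A is a fixed dilation matrix.\<close>
locale dilation =
  fixes A :: "real^'n^'n"
  assumes dilation: "dilation_matrix A"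
begin

lemma inverse: "matrix_inv A ** A = mat 1" "A ** matrix_inv A = mat 1"
  using dilation_invertible[OF dilation] by blast+

text \<open>The powers of the inverse decay geometrically.\<close>
lemma inv_iter_decay:
  "\<exists>c q. 0 \<le> c \<and> 0 < q \<and> q < 1 \<and> (\<forall>k x. norm (inv_iter A k x) \<le> c * q ^ k * norm x)"
  using real_matrix_power_decay[of "matrix_inv A"] dilation_inverse_eigenvalues[OF dilation]
  unfolding inv_iter_def by blast

text \<open>The series defining the norm converges, and is dominated by a multiple of the
  squared Euclidean norm.\<close>
lemma inv_iter_square_sum:
  "\<exists>C. \<forall>x. summable (\<lambda>j. (norm (inv_iter A j x))\<^sup>2) \<and> (\<Sum>j. (norm (inv_iter A j x))\<^sup>2) \<le> C * (norm x)\<^sup>2"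
proof -
  obtain c q where q: "0 < q" "q < 1" and decay: "\<And>k x. norm (inv_iter A k x) \<le> c * q ^ k * norm x"
    using inv_iter_decay by blast
  have q2: "norm (q\<^sup>2) < 1" using q by (simp add: abs_square_less_1)
  have "summable (\<lambda>j. (norm (inv_iter A j x))\<^sup>2) \<and>
      (\<Sum>j. (norm (inv_iter A j x))\<^sup>2) \<le> c\<^sup>2 / (1 - q\<^sup>2) * (norm x)\<^sup>2" for x
  proof
    have geom: "(\<lambda>j. c\<^sup>2 * (norm x)\<^sup>2 * (q\<^sup>2) ^ j) sums (c\<^sup>2 * (norm x)\<^sup>2 * (1 / (1 - q\<^sup>2)))"
      by (intro sums_mult geometric_sums q2)
    have bound: "norm ((norm (inv_iter A j x))\<^sup>2) \<le> c\<^sup>2 * (norm x)\<^sup>2 * (q\<^sup>2) ^ j" for j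
    proof -
      have "(norm (inv_iter A j x))\<^sup>2 \<le> (c * q ^ j * norm x)\<^sup>2"
        by (intro power_mono decay) simp
      thus ?thesis by (simp add: power_mult_distrib power_mult[symmetric] mult_ac)
    qed
    show summable: "summable (\<lambda>j. (norm (inv_iter A j x))\<^sup>2)"
      by (rule summable_comparison_test'[OF sums_summable[OF geom] bound])
    have "(\<Sum>j. (norm (inv_iter A j x))\<^sup>2) \<le> (\<Sum>j. c\<^sup>2 * (norm x)\<^sup>2 * (q\<^sup>2) ^ j)"
      using bound by (intro suminf_le summable sums_summable[OF geom]) auto
    also have "\<dots> = c\<^sup>2 / (1 - q\<^sup>2) * (norm x)\<^sup>2" using geom by (simp add: sums_iff)
    finally show "(\<Sum>j. (norm (inv_iter A j x))\<^sup>2) \<le> c\<^sup>2 / (1 - q\<^sup>2) * (norm x)\<^sup>2" .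
  qed
  thus ?thesis by blast
qed

lemma summable_inv_iter: "summable (\<lambda>j. (norm (inv_iter A j x))\<^sup>2)"
  using inv_iter_square_sum by blast

text \<open>The norm is equivalent to the Euclidean norm.\<close>
lemma normA_upper: "\<exists>C>0. \<forall>x. normA A x \<le> C * norm x"
proof -
  obtain C where C: "\<And>x. (\<Sum>j. (norm (inv_iter A j x))\<^sup>2) \<le> C * (norm x)\<^sup>2"
    using inv_iter_square_sum by blast
  have "normA A x \<le> max 1 (sqrt C) * norm x" for x
  proof -
    have "normA A x \<le> sqrt C * norm x"
      using real_sqrt_le_mono[OF C[of x]] by (simp add: normA_inv_iter real_sqrt_mult)
    also have "\<dots> \<le> max 1 (sqrt C) * norm x" by (intro mult_right_mono) auto
    finally show ?thesis .
  qed
  thus ?thesis by (intro exI[of _ "max 1 (sqrt C)"]) auto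
qed

lemma norm_le_normA: "norm x \<le> normA A x"
proof -
  have "(\<Sum>j<1. (norm (inv_iter A j x))\<^sup>2) \<le> (\<Sum>j. (norm (inv_iter A j x))\<^sup>2)"
    by (rule sum_le_suminf[OF summable_inv_iter]) auto
  hence "sqrt ((norm x)\<^sup>2) \<le> normA A x"
    unfolding normA_inv_iter by (intro real_sqrt_le_mono) (simp add: inv_iter_def)
  thus ?thesis by simp
qed

lemma normA_nonneg: "0 \<le> normA A x"
  by (simp add: normA_inv_iter suminf_nonneg summable_inv_iter)

lemma normA_scaleR: "normA A (t *\<^sub>R x) = \<bar>t\<bar> * normA A x"
proof -
  have "(\<Sum>j. (norm (inv_iter A j (t *\<^sub>R x)))\<^sup>2) = (\<Sum>j. t\<^sup>2 * (norm (inv_iter A j x))\<^sup>2)"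
    by (simp add: inv_iter_scaleR power_mult_distrib)
  also have "\<dots> = t\<^sup>2 * (\<Sum>j. (norm (inv_iter A j x))\<^sup>2)"
    by (rule suminf_mult[OF summable_inv_iter])
  finally show ?thesis unfolding normA_inv_iter by (simp add: real_sqrt_mult)
qed

lemma normA_uminus: "normA A (- x) = normA A x"
  using normA_scaleR[of "-1" x] by simp

lemma normA_triangle: "normA A (x + y) \<le> normA A x + normA A y"
proof -
  have partial: "L2_set (\<lambda>j. norm (inv_iter A j z)) {..<N} \<le> normA A z" for z N
    unfolding L2_set_def normA_inv_iter
    by (intro real_sqrt_le_mono sum_le_suminf summable_inv_iter) auto
  have "(\<Sum>j<N. (norm (inv_iter A j (x + y)))\<^sup>2) \<le> (normA A x + normA A y)\<^sup>2" for N
  proof -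
    have "L2_set (\<lambda>j. norm (inv_iter A j (x + y))) {..<N}
        \<le> L2_set (\<lambda>j. norm (inv_iter A j x) + norm (inv_iter A j y)) {..<N}"
      by (intro L2_set_mono) (auto simp: inv_iter_add norm_triangle_ineq)
    also have "\<dots> \<le> L2_set (\<lambda>j. norm (inv_iter A j x)) {..<N} + L2_set (\<lambda>j. norm (inv_iter A j y)) {..<N}"
      by (rule L2_set_triangle_ineq)
    also have "\<dots> \<le> normA A x + normA A y"
      by (intro add_mono partial)
    finally have "sqrt (\<Sum>j<N. (norm (inv_iter A j (x + y)))\<^sup>2) \<le> normA A x + normA A y"
      by (simp add: L2_set_def)
    from power_mono[OF this, of 2] show ?thesis by (simp add: sum_nonneg)
  qed
  hence "(\<Sum>j. (norm (inv_iter A j (x + y)))\<^sup>2) \<le> (normA A x + normA A y)\<^sup>2"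
    by (intro suminf_le_const summable_inv_iter)
  hence "normA A (x + y) \<le> sqrt ((normA A x + normA A y)\<^sup>2)"
    unfolding normA_inv_iter by (rule real_sqrt_le_mono)
  thus ?thesis using normA_nonneg[of x] normA_nonneg[of y] by simp
qed

text \<open>The key identity: applying A adds the squared Euclidean norm of the image,
  because the series for A x is the series for x with one extra leading term.\<close>
lemma normA_A_squared: "(normA A (A *v x))\<^sup>2 = (norm (A *v x))\<^sup>2 + (normA A x)\<^sup>2"
proof -
  have shift: "inv_iter A (Suc j) (A *v x) = inv_iter A j x" for j
    by (simp add: inv_iter_Suc matrix_vector_mul_assoc inverse)
  have "(\<Sum>j. (norm (inv_iter A j (A *v x)))\<^sup>2)
      = (norm (A *v x))\<^sup>2 + (\<Sum>j. (norm (inv_iter A (Suc j) (A *v x)))\<^sup>2)"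
    using suminf_split_head[OF summable_inv_iter[of "A *v x"]] by (simp add: inv_iter_def)
  also have "\<dots> = (norm (A *v x))\<^sup>2 + (\<Sum>j. (norm (inv_iter A j x))\<^sup>2)"
    by (simp add: shift)
  finally show ?thesis
    unfolding normA_inv_iter by (simp add: suminf_nonneg summable_inv_iter)
qed

end

section \<open>Elementary facts about the dynamics\<close>

text \<open>Only finitely many lattice points lie in a Euclidean ball.\<close>
lemma finite_int_vecs_ball: "finite {v \<in> (int_vecs :: (real^'n) set). norm v \<le> r}"
proof -
  define S where "S = (of_int ` {-\<lceil>r\<rceil>..\<lceil>r\<rceil>} :: real set)"
  have "{v \<in> (int_vecs :: (real^'n) set). norm v \<le> r} \<subseteq> vec_lambda ` (PiE UNIV (\<lambda>_. S))"
  proof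
    fix v :: "real^'n"
    assume v: "v \<in> {v \<in> int_vecs. norm v \<le> r}"
    have "v $ i \<in> S" for i
    proof -
      obtain z where z: "v $ i = of_int z"
        using v by (auto simp: int_vecs_def elim: Ints_cases)
      have "\<bar>v $ i\<bar> \<le> r" using v component_le_norm_cart[of v i] by auto
      hence "-\<lceil>r\<rceil> \<le> z \<and> z \<le> \<lceil>r\<rceil>" unfolding z by linarith
      thus ?thesis by (simp add: S_def z)
    qed
    hence "vec_nth v \<in> PiE UNIV (\<lambda>_. S)" by auto
    thus "v \<in> vec_lambda ` (PiE UNIV (\<lambda>_. S))" by (metis image_eqI vec_lambda_eta)
  qed
  moreover have "finite (vec_lambda ` (PiE UNIV (\<lambda>_. S)))"
    by (intro finite_imageI finite_PiE) (auto simp: S_def)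
  ultimately show ?thesis by (rule finite_subset)
qed

text \<open>Elementary estimates for the recursion a' \<le> a / m + \<rho> with m > 1: above the
  threshold R = M \<rho> / (m - 1) the value strictly decreases, below it stays below.\<close>
lemma recursion_decreases:
  fixes m M \<rho> a a' :: real
  assumes "1 < m" "m \<le> M" "0 \<le> \<rho>" "M * \<rho> / (m - 1) < a" "a' \<le> a / m + \<rho>"
  shows "a' < a"
proof -
  have "M * \<rho> < a * (m - 1)" using assms(1,4) by (simp add: pos_divide_less_eq)
  moreover have "m * \<rho> \<le> M * \<rho>" using assms(2,3) by (rule mult_right_mono)
  ultimately have "a / m + \<rho> < a" using assms(1) by (simp add: field_simps)
  with assms(5) show ?thesis by linarith
qed

lemma recursion_stays_below:
  fixes m M \<rho> a a' :: real
  assumes "1 < m" "m \<le> M" "0 \<le> \<rho>" "a \<le> M * \<rho> / (m - 1)" "a' \<le> a / m + \<rho>"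
  shows "a' \<le> M * \<rho> / (m - 1)"
proof -
  define R where "R = M * \<rho> / (m - 1)"
  have "R * (m - 1) = M * \<rho>" using assms(1) by (simp add: R_def)
  moreover have "m * \<rho> \<le> M * \<rho>" using assms(2,3) by (rule mult_right_mono)
  ultimately have "R / m + \<rho> \<le> R" using assms(1) by (simp add: field_simps)
  moreover have "a / m \<le> R / m" using assms(1,4) unfolding R_def by (intro divide_right_mono) auto
  ultimately show ?thesis using assms(5) unfolding R_def by linarith
qed

text \<open>A sequence in a set whose sublevel sets of f are finite, along which f strictly
  decreases above R and R is an invariant upper bound, eventually stays below R.\<close>
lemma eventually_below_threshold:
  fixes x :: "nat \<Rightarrow> 'a" and f :: "'a \<Rightarrow> real"
  assumes fin: "\<And>C. finite {v \<in> S. f v \<le> C}" and S: "\<And>j. x j \<in> S"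
    and dec: "\<And>j. R < f (x j) \<Longrightarrow> f (x (Suc j)) < f (x j)"
    and inv: "\<And>j. f (x j) \<le> R \<Longrightarrow> f (x (Suc j)) \<le> R"
  shows "\<exists>N. \<forall>j\<ge>N. f (x j) \<le> R"
proof (cases "\<exists>N. f (x N) \<le> R")
  case True
  then obtain N where N: "f (x N) \<le> R" by blast
  have "f (x j) \<le> R" if "N \<le> j" for j
    using that by (induction j rule: dec_induct) (use N inv in auto)
  thus ?thesis by blast
next
  case False
  hence decreasing: "strict_mono (\<lambda>j. - f (x j))"
    by (intro strict_monoI_Suc) (simp add: dec not_le)
  hence "inj x"
    by (intro injI) (simp add: strict_mono_eq[OF decreasing, symmetric])
  moreover have "f (x j) \<le> f (x 0)" for j
    using strict_mono_less_eq[OF decreasing, of 0 j] by simp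
  hence "range x \<subseteq> {v \<in> S. f v \<le> f (x 0)}" using S by auto
  hence "finite (range x)" using fin finite_subset by blast
  ultimately have "finite (UNIV :: nat set)" using finite_imageD by blast
  thus ?thesis by simp
qed

text \<open>A sequence which eventually takes values in a finite set and whose successor
  depends only on the current value is eventually periodic.\<close>
lemma eventually_periodic:
  fixes x :: "nat \<Rightarrow> 'a"
  assumes fin: "finite T" and T: "\<And>j. N \<le> j \<Longrightarrow> x j \<in> T"
    and det: "\<And>i k. x i = x k \<Longrightarrow> x (Suc i) = x (Suc k)"
  shows "\<exists>N p. 0 < p \<and> (\<forall>j\<ge>N. x (j + p) = x j)"
proof -
  have "range (\<lambda>t. x (N + t)) \<subseteq> T" using T by auto
  hence "finite (range (\<lambda>t. x (N + t)))" using fin finite_subset by blast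
  hence "\<not> inj (\<lambda>t. x (N + t))" using finite_imageD by blast
  then obtain t1 t2 where t: "t1 \<noteq> t2" "x (N + t1) = x (N + t2)"
    unfolding inj_def by blast
  obtain i k where ik: "i < k" "x i = x k"
  proof (cases "t1 < t2")
    case True
    with t show ?thesis by (intro that[of "N + t1" "N + t2"]) auto
  next
    case False
    with t show ?thesis by (intro that[of "N + t2" "N + t1"]) auto
  qed
  have shift: "x (i + t) = x (k + t)" for t
  proof (induction t)
    case (Suc t)
    thus ?case using det[OF Suc.IH] by simp
  qed (simp add: ik)
  have "x (j + (k - i)) = x j" if "i \<le> j" for j
  proof -
    obtain t where "j = i + t" using \<open>i \<le> j\<close> le_Suc_ex by blast
    with ik show ?thesis using shift[of t] by (simp add: add.commute)
  qed
  with ik show ?thesis by (intro exI[of _ i] exI[of _ "k - i"]) auto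
qed

section \<open>The division algorithm with respect to a dilation matrix\<close>

context dilation
begin

text \<open>The smallest and largest expansion factors of A with respect to the norm, and the
  largest norm of a point of the closed fundamental cube.\<close>
definition expansion_min :: real where
  "expansion_min = Inf {normA A (A *v x) | x. normA A x = 1}"

definition expansion_max :: real where
  "expansion_max = Sup {normA A (A *v x) | x. normA A x = 1}"

definition cube_radius :: real where
  "cube_radius = Sup (normA A ` closure half_cube)"

text \<open>Normalization to the unit sphere of the norm.\<close>
lemma normA_pos: "x \<noteq> 0 \<Longrightarrow> 0 < normA A x"
  by (metis norm_le_normA zero_less_norm_iff order_less_le_trans)

lemma normA_normalize: "0 < normA A y \<Longrightarrow> normA A ((1 / normA A y) *\<^sub>R y) = 1"
  by (simp add: normA_scaleR)

text \<open>The infimum and supremum defining m and M are taken over a non-empty bounded set.\<close>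
lemma expansions_nonempty: "{normA A (A *v x) | x. normA A x = 1} \<noteq> {}"
  using normA_normalize[OF normA_pos[of 1]] by auto

lemma expansions_bdd_below: "bdd_below {normA A (A *v x) | x. normA A x = 1}"
  by (rule bdd_belowI[of _ 0]) (auto simp: normA_nonneg)

lemma expansions_bdd_above: "bdd_above {normA A (A *v x) | x. normA A x = 1}"
proof -
  obtain C where C: "C > 0" "\<And>x. normA A x \<le> C * norm x" using normA_upper by blast
  obtain K where K: "K > 0" "\<And>x. norm (A *v x) \<le> norm x * K"
    using bounded_linear.pos_bounded[OF matrix_vector_mul_bounded_linear] by blast
  have "normA A (A *v x) \<le> C * K" if "normA A x = 1" for x
  proof -
    have "normA A (A *v x) \<le> C * (norm x * K)"
      using C K(2)[of x] by (meson mult_left_mono less_imp_le order_trans)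
    also have "\<dots> \<le> C * K"
      using C(1) K(1) norm_le_normA[of x] that by (intro mult_left_mono mult_left_le_one_le) auto
    finally show ?thesis .
  qed
  thus ?thesis by (intro bdd_aboveI[of _ "C * K"]) auto
qed

text \<open>A expands every vector by a factor at least m = expansion_min, and m > 1 because
  the squared norm of A x exceeds that of x by the squared Euclidean norm of A x,
  which is bounded below by a fixed multiple of the norm of x.\<close>
lemma expansion_min_gt_1: "1 < expansion_min"
proof -
  obtain C where C: "C > 0" "\<And>x. normA A x \<le> C * norm x" using normA_upper by blast
  obtain KB where KB: "KB > 0" "\<And>y. norm (matrix_inv A *v y) \<le> norm y * KB"
    using bounded_linear.pos_bounded[OF matrix_vector_mul_bounded_linear] by blast
  define K where "K = C * KB"
  have K: "0 < K" using C(1) KB(1) by (simp add: K_def)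
  have "sqrt (1 + (1 / K)\<^sup>2) \<le> normA A (A *v x)" if x: "normA A x = 1" for x
  proof -
    have "1 \<le> C * norm (matrix_inv A *v (A *v x))"
      using C(2)[of x] x by (simp add: matrix_vector_mul_assoc inverse)
    also have "\<dots> \<le> C * (norm (A *v x) * KB)"
      using C KB by (intro mult_left_mono) auto
    finally have "1 / K \<le> norm (A *v x)"
      using K by (simp add: K_def divide_le_eq mult_ac)
    hence "1 + (1 / K)\<^sup>2 \<le> (normA A (A *v x))\<^sup>2"
      using normA_A_squared[of x] x K by (simp add: power_mono)
    thus ?thesis using normA_nonneg real_le_lsqrt by blast
  qed
  hence "sqrt (1 + (1 / K)\<^sup>2) \<le> expansion_min"
    unfolding expansion_min_def by (intro cInf_greatest expansions_nonempty) auto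
  moreover have "1 < sqrt (1 + (1 / K)\<^sup>2)" using K by simp
  ultimately show ?thesis by linarith
qed

text \<open>By homogeneity, m is a lower expansion factor for every vector, so the inverse of A
  contracts by at least the factor m.\<close>
lemma expansion_min_le: "expansion_min * normA A y \<le> normA A (A *v y)"
proof (cases "y = 0")
  case True
  thus ?thesis using normA_scaleR[of 0 0] by simp
next
  case False
  define t where "t = normA A y"
  have t: "0 < t" using normA_pos[OF False] by (simp add: t_def)
  have "expansion_min \<le> normA A (A *v ((1 / t) *\<^sub>R y))"
    unfolding expansion_min_def
    using normA_normalize[OF t[unfolded t_def]] by (intro cInf_lower expansions_bdd_below) (auto simp: t_def)
  also have "\<dots> = normA A (A *v y) / t"
    using t by (simp add: matrix_vector_mult_scaleR normA_scaleR)
  finally show ?thesis using t by (simp add: le_divide_eq t_def)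
qed

lemma normA_inverse_le: "normA A (matrix_inv A *v z) \<le> normA A z / expansion_min"
  using expansion_min_le[of "matrix_inv A *v z"] expansion_min_gt_1
  by (simp add: matrix_vector_mul_assoc inverse le_divide_eq mult.commute)

lemma expansion_min_le_max: "expansion_min \<le> expansion_max"
  unfolding expansion_min_def expansion_max_def
  by (intro cInf_le_cSup expansions_nonempty expansions_bdd_below expansions_bdd_above)

text \<open>The closed cube is bounded, so its norms have a finite supremum \<rho> \<ge> 0.\<close>
lemma cube_radius_upper: "f \<in> half_cube \<Longrightarrow> normA A f \<le> cube_radius"
proof -
  obtain C where C: "C > 0" "\<And>x. normA A x \<le> C * norm x" using normA_upper by blast
  have "closure half_cube \<subseteq> cball (0 :: real^'n) (real CARD('n))"
  proof (rule closure_minimal[OF _ closed_cball], rule subsetI)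
    fix f :: "real^'n"
    assume f: "f \<in> half_cube"
    have "norm f \<le> (\<Sum>i\<in>UNIV. \<bar>f $ i\<bar>)" by (rule norm_le_l1_cart)
    also have "\<dots> \<le> (\<Sum>i\<in>(UNIV :: 'n set). 1)"
    proof (intro sum_mono)
      fix i
      have "-1/2 \<le> f $ i" "f $ i < 1/2" using f by (auto simp: half_cube_def)
      thus "\<bar>f $ i\<bar> \<le> 1" by linarith
    qed
    finally show "f \<in> cball 0 (real CARD('n))" by simp
  qed
  hence "normA A f \<le> C * real CARD('n)" if "f \<in> closure half_cube" for f
    using that C by (meson mem_cball_0 mult_left_mono less_imp_le order_trans subsetD)
  hence "bdd_above (normA A ` closure half_cube)" by (intro bdd_aboveI) auto
  thus "f \<in> half_cube \<Longrightarrow> normA A f \<le> cube_radius"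
    unfolding cube_radius_def using closure_subset by (intro cSup_upper) auto
qed

lemma cube_radius_nonneg: "0 \<le> cube_radius"
  using cube_radius_upper[of 0] normA_scaleR[of 0 0] by (simp add: half_cube_def)

text \<open>One step of the expansion x = A y + r with a digit r = A f, f in the cube, gives
  y = B x - f for the inverse B of A, so the norm of y is at most the norm of x divided
  by m plus the cube radius.\<close>
lemma digit_step:
  assumes "x - A *v y \<in> digits A"
  shows "normA A y \<le> normA A x / expansion_min + cube_radius"
proof -
  obtain f where f: "f \<in> half_cube" "x - A *v y = A *v f"
    using assms unfolding digits_def by force
  have "x = A *v (y + f)"
    using f(2) by (simp add: matrix_vector_right_distrib algebra_simps)
  hence "matrix_inv A *v x = y + f"
    by (simp add: matrix_vector_mul_assoc inverse)
  hence "y = matrix_inv A *v x + - f" by simp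
  hence "normA A y \<le> normA A (matrix_inv A *v x) + normA A (- f)"
    using normA_triangle by metis
  also have "\<dots> \<le> normA A x / expansion_min + cube_radius"
    using normA_inverse_le[of x] cube_radius_upper[OF f(1)] by (simp add: normA_uminus)
  finally show ?thesis .
qed

text \<open>The quotient in the division x = A y + r is unique: two candidates differ by a
  vector of the cube difference F - F, which contains no non-zero lattice point.\<close>
lemma quotient_unique:
  assumes y: "y \<in> int_vecs" "y' \<in> int_vecs"
    and d: "x - A *v y \<in> digits A" "x - A *v y' \<in> digits A"
  shows "y = y'"
proof -
  obtain f f' where f: "f \<in> half_cube" "x - A *v y = A *v f" "f' \<in> half_cube" "x - A *v y' = A *v f'"
    using d unfolding digits_def by force
  have "A *v (y' - y) = A *v (f - f')"
    using f(2,4) by (simp add: matrix_vector_mult_diff_distrib algebra_simps)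
  hence "matrix_inv A *v (A *v (y' - y)) = matrix_inv A *v (A *v (f - f'))" by simp
  hence e: "y' - y = f - f'" by (simp add: matrix_vector_mul_assoc inverse)
  show ?thesis
  proof (subst Finite_Cartesian_Product.vec_eq_iff, rule allI, rule ccontr)
    fix i
    assume ne: "y $ i \<noteq> y' $ i"
    have "y' $ i - y $ i \<in> \<int>" using y unfolding int_vecs_def by auto
    hence "1 \<le> \<bar>y' $ i - y $ i\<bar>" using ne by (intro Ints_nonzero_abs_ge1) auto
    moreover have "y' $ i - y $ i = f $ i - f' $ i" using e by (metis vector_minus_component)
    moreover have "\<bar>f $ i - f' $ i\<bar> < 1"
    proof -
      have "-1/2 \<le> f $ i" "f $ i < 1/2" "-1/2 \<le> f' $ i" "f' $ i < 1/2"
        using f(1,3) unfolding half_cube_def by auto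
      thus ?thesis by linarith
    qed
    ultimately show False by linarith
  qed
qed

text \<open>Sublevel sets of the norm contain only finitely many lattice points.\<close>
lemma finite_normA_sublevel: "finite {v \<in> int_vecs. normA A v \<le> C}"
  by (rule finite_subset[OF _ finite_int_vecs_ball[of C]]) (auto intro: order_trans norm_le_normA)

end

section \<open>Main theorem\<close>

theorem mainTheorem3:
  fixes A :: "real^'n^'n"
  assumes dil: "dilation_matrix A"
  defines "m \<equiv> Inf {normA A (A *v x) | x. normA A x = 1}"
      and "M \<equiv> Sup {normA A (A *v x) | x. normA A x = 1}"
      and "\<rho> \<equiv> Sup (normA A ` closure half_cube)"
  defines "R \<equiv> M * \<rho> / (m - 1)"
  shows "1 < m \<and>
         (\<forall>x :: nat \<Rightarrow> real^'n.
           ((\<forall>j. x j \<in> int_vecs) \<and> (\<forall>j. x j - A *v x (Suc j) \<in> digits A)) \<longrightarrow>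
           (\<forall>j. normA A (x j) > R \<longrightarrow> normA A (x (Suc j)) < normA A (x j)) \<and>
           (\<forall>j. normA A (x j) \<le> R \<longrightarrow> normA A (x (Suc j)) \<le> R) \<and>
           (\<exists>N. \<forall>j\<ge>N. normA A (x j) \<le> R) \<and>
           (\<exists>N p. 0 < p \<and> (\<forall>j\<ge>N. x (j + p) = x j)))"
proof -
  interpret dilation A using dil by unfold_locales
  have constants: "m = expansion_min" "M = expansion_max" "\<rho> = cube_radius"
    by (simp_all add: m_def M_def \<rho>_def expansion_min_def expansion_max_def cube_radius_def)
  have m: "1 < m" "m \<le> M" "0 \<le> \<rho>"
    using expansion_min_gt_1 expansion_min_le_max cube_radius_nonneg by (simp_all add: constants)
  have "(\<forall>j. normA A (x j) > R \<longrightarrow> normA A (x (Suc j)) < normA A (x j)) \<and>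
        (\<forall>j. normA A (x j) \<le> R \<longrightarrow> normA A (x (Suc j)) \<le> R) \<and>
        (\<exists>N. \<forall>j\<ge>N. normA A (x j) \<le> R) \<and>
        (\<exists>N p. 0 < p \<and> (\<forall>j\<ge>N. x (j + p) = x j))"
    if lattice: "\<And>j. x j \<in> int_vecs" and digit: "\<And>j. x j - A *v x (Suc j) \<in> digits A" for x
  proof -
    have step: "normA A (x (Suc j)) \<le> normA A (x j) / m + \<rho>" for j
      using digit_step[OF digit] by (simp add: constants)
    have decrease: "R < normA A (x j) \<Longrightarrow> normA A (x (Suc j)) < normA A (x j)" for j
      using recursion_decreases[OF m _ step] by (simp add: R_def)
    have stay: "normA A (x j) \<le> R \<Longrightarrow> normA A (x (Suc j)) \<le> R" for j
      using recursion_stays_below[OF m _ step] by (simp add: R_def)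
    obtain N where N: "\<And>j. N \<le> j \<Longrightarrow> normA A (x j) \<le> R"
      using eventually_below_threshold[of int_vecs "normA A" x R] finite_normA_sublevel
        lattice decrease stay by blast
    have "x i = x k \<Longrightarrow> x (Suc i) = x (Suc k)" for i k
      using quotient_unique[OF lattice lattice digit, of i "Suc k"] digit[of k] by simp
    hence "\<exists>N p. 0 < p \<and> (\<forall>j\<ge>N. x (j + p) = x j)"
      using eventually_periodic[OF finite_normA_sublevel, of N x R] N lattice by blast
    with decrease stay N show ?thesis by blast
  qed
  with m(1) show ?thesis by blast
qed

end
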